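(* Let $K$ be a field of characteristic zero, let $n\geq 1$ be an integer, and let $k=(k_1,k_2,\ldots,k_n)\in K^n$ with $k_1k_2\cdots k_n\neq 0$. Then every left ideal of the $n$th hom-associative Weyl algebra $A_n^k$ is principal (as a left ideal of $A_n^k$), and every right ideal of $A_n^k$ is principal (as a right ideal of $A_n^k$).
   Context: The $n$th Weyl algebra $A_n$ over $K$ is the associative unital $K$-algebra generated by $x_1,\ldots,x_n,y_1,\ldots,y_n$ subject to the relations $x_ix_j=x_jx_i$ and $y_iy_j=y_jy_i$ for all $i,j$, $x_iy_j=y_jx_i$ for $i\neq j$, and $x_iy_i=y_ix_i+1$ for all $i$. For $k=(k_1,\ldots,k_n)\in K^n$, let $\alpha_k$ be the $K$-algebra automorphism of $A_n$ with $\alpha_k(x_i)=x_i$, $\alpha_k(y_i)=y_i+k_i$ for $1\leq i\leq n$ and $\alpha_k(1_{A_n})=1_{A_n}$. The $n$th hom-associative Weyl algebra $A_n^k$ is the Yau twist of $A_n$ by $\alpha_k$: it is the $K$-vector space $A_n$ with the (in general non-associative, non-unital) bilinear product $a*b:=\alpha_k(ab)$, where $ab$ is the product in $A_n$. A left (respectively right) ideal of $A_n^k$ is a $K$-subspace $I$ such that $a*q\in I$ (respectively $q*a\in I$) for all $a\in A_n$ and $q\in I$. The left (right) ideal of $A_n^k$ generated by a set of elements is the smallest left (right) ideal of $A_n^k$ containing that set; a left (right) ideal is principal if it is generated by a single element. *)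

theory Defs
  imports Complex_Main "HOL-Analysis.Finite_Cartesian_Product"
begin

text \<open>The Weyl algebra is constructed from its presentation: expressions in the generators and the
  scalars, modulo the smallest congruence that contains the laws of associative unital
  \<open>K\<close>-algebras and the defining relations. The generators are indexed by a type \<open>'n\<close>, so that
  \<open>n = CARD('n)\<close>.\<close>

datatype ('k, 'n) weyl_term =
    TX 'n
  | TY 'n
  | TC 'k
  | TNeg "('k, 'n) weyl_term"
  | TAdd "('k, 'n) weyl_term" "('k, 'n) weyl_term"
  | TMul "('k, 'n) weyl_term" "('k, 'n) weyl_term"

inductive weyl_eq :: "('k::field, 'n) weyl_term \<Rightarrow> ('k, 'n) weyl_term \<Rightarrow> bool" where
  weyl_refl: "weyl_eq s s"
| weyl_sym: "weyl_eq s t \<Longrightarrow> weyl_eq t s"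
| weyl_trans: "weyl_eq s t \<Longrightarrow> weyl_eq t u \<Longrightarrow> weyl_eq s u"
| weyl_cong_neg: "weyl_eq s s' \<Longrightarrow> weyl_eq (TNeg s) (TNeg s')"
| weyl_cong_add: "weyl_eq s s' \<Longrightarrow> weyl_eq t t' \<Longrightarrow> weyl_eq (TAdd s t) (TAdd s' t')"
| weyl_cong_mul: "weyl_eq s s' \<Longrightarrow> weyl_eq t t' \<Longrightarrow> weyl_eq (TMul s t) (TMul s' t')"
| weyl_add_assoc: "weyl_eq (TAdd (TAdd s t) u) (TAdd s (TAdd t u))"
| weyl_add_comm: "weyl_eq (TAdd s t) (TAdd t s)"
| weyl_add_zero: "weyl_eq (TAdd (TC 0) s) s"
| weyl_add_neg: "weyl_eq (TAdd (TNeg s) s) (TC 0)"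
| weyl_mul_assoc: "weyl_eq (TMul (TMul s t) u) (TMul s (TMul t u))"
| weyl_mul_one_left: "weyl_eq (TMul (TC 1) s) s"
| weyl_mul_one_right: "weyl_eq (TMul s (TC 1)) s"
| weyl_distrib_left: "weyl_eq (TMul s (TAdd t u)) (TAdd (TMul s t) (TMul s u))"
| weyl_distrib_right: "weyl_eq (TMul (TAdd s t) u) (TAdd (TMul s u) (TMul t u))"
| weyl_scalar_add: "weyl_eq (TC (a + b)) (TAdd (TC a) (TC b))"
| weyl_scalar_mul: "weyl_eq (TC (a * b)) (TMul (TC a) (TC b))"
| weyl_scalar_central: "weyl_eq (TMul (TC a) s) (TMul s (TC a))"
| weyl_rel_xx: "weyl_eq (TMul (TX i) (TX j)) (TMul (TX j) (TX i))"
| weyl_rel_yy: "weyl_eq (TMul (TY i) (TY j)) (TMul (TY j) (TY i))"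
| weyl_rel_xy_neq: "i \<noteq> j \<Longrightarrow> weyl_eq (TMul (TX i) (TY j)) (TMul (TY j) (TX i))"
| weyl_rel_xy: "weyl_eq (TMul (TX i) (TY i)) (TAdd (TMul (TY i) (TX i)) (TC 1))"

quotient_type (overloaded) ('k, 'n) weyl = "('k::field, 'n) weyl_term" / weyl_eq
  by (intro equivpI reflpI sympI transpI) (blast intro: weyl_eq.intros)+

text \<open>The representation in which \<open>y\<^sub>i\<close> acts by multiplication with a variable and \<open>x\<^sub>i\<close> by partial
  differentiation (on coefficient functions of formal power series) is used only to show that
  the quotient is not the zero ring, as the class \<^class>\<open>ring_1\<close> requires.\<close>

primrec weyl_act ::
  "('k::field, 'n) weyl_term \<Rightarrow> (('n \<Rightarrow> nat) \<Rightarrow> 'k) \<Rightarrow> (('n \<Rightarrow> nat) \<Rightarrow> 'k)" where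
  "weyl_act (TX i) f = (\<lambda>m. of_nat (Suc (m i)) * f (m(i := Suc (m i))))"
| "weyl_act (TY i) f = (\<lambda>m. if m i = 0 then 0 else f (m(i := m i - 1)))"
| "weyl_act (TC c) f = (\<lambda>m. c * f m)"
| "weyl_act (TNeg s) f = (\<lambda>m. - weyl_act s f m)"
| "weyl_act (TAdd s t) f = (\<lambda>m. weyl_act s f m + weyl_act t f m)"
| "weyl_act (TMul s t) f = weyl_act s (weyl_act t f)"

lemma weyl_act_add:
  "weyl_act s (\<lambda>m. f m + g m) = (\<lambda>m. weyl_act s f m + weyl_act s g m)"
  by (induction s arbitrary: f g) (auto simp: algebra_simps intro!: ext)

lemma weyl_act_scale: "weyl_act s (\<lambda>m. c * f m) = (\<lambda>m. c * weyl_act s f m)"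
  by (induction s arbitrary: f) (auto simp: algebra_simps intro!: ext)

lemma weyl_act_cong: "weyl_eq s t \<Longrightarrow> weyl_act s = weyl_act t"
proof (induction rule: weyl_eq.induct)
  case (weyl_rel_xx i j)
  show ?case by (cases "i = j") (auto simp: fun_eq_iff fun_upd_twist)
next
  case (weyl_rel_yy i j)
  show ?case by (cases "i = j") (auto simp: fun_eq_iff fun_upd_twist)
next
  case (weyl_rel_xy_neq i j)
  then show ?case by (auto simp: fun_eq_iff fun_upd_twist)
next
  case (weyl_rel_xy i)
  show ?case by (auto simp: fun_eq_iff algebra_simps fun_upd_idem)
qed (auto simp: weyl_act_add weyl_act_scale algebra_simps intro!: ext)

lemma weyl_nontrivial: "\<not> weyl_eq (TC 0) (TC 1)"
proof
  assume "weyl_eq (TC 0) (TC 1 :: ('a, 'b) weyl_term)"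
  from weyl_act_cong[OF this]
  have "weyl_act (TC 0 :: ('a, 'b) weyl_term) (\<lambda>_. 1) (\<lambda>_. 0) = weyl_act (TC 1 :: ('a, 'b) weyl_term) (\<lambda>_. 1) (\<lambda>_. 0)"
    by simp
  then show False by simp
qed

instantiation weyl :: (field, type) ring_1
begin

lift_definition zero_weyl :: "('a, 'b) weyl" is "TC 0" .
lift_definition one_weyl :: "('a, 'b) weyl" is "TC 1" .
lift_definition uminus_weyl :: "('a, 'b) weyl \<Rightarrow> ('a, 'b) weyl" is TNeg
  by (rule weyl_cong_neg)
lift_definition plus_weyl :: "('a, 'b) weyl \<Rightarrow> ('a, 'b) weyl \<Rightarrow> ('a, 'b) weyl" is TAdd
  by (rule weyl_cong_add)
lift_definition times_weyl :: "('a, 'b) weyl \<Rightarrow> ('a, 'b) weyl \<Rightarrow> ('a, 'b) weyl" is TMul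
  by (rule weyl_cong_mul)
definition minus_weyl :: "('a, 'b) weyl \<Rightarrow> ('a, 'b) weyl \<Rightarrow> ('a, 'b) weyl" where
  "minus_weyl a b = a + - b"

instance
proof
  fix a b c :: "('a, 'b) weyl"
  show "a + b + c = a + (b + c)" by transfer (rule weyl_add_assoc)
  show "a + b = b + a" by transfer (rule weyl_add_comm)
  show "0 + a = a" by transfer (rule weyl_add_zero)
  show "- a + a = 0" by transfer (rule weyl_add_neg)
  show "a - b = a + - b" by (rule minus_weyl_def)
  show "a * b * c = a * (b * c)" by transfer (rule weyl_mul_assoc)
  show "1 * a = a" by transfer (rule weyl_mul_one_left)
  show "a * 1 = a" by transfer (rule weyl_mul_one_right)
  show "(a + b) * c = a * c + b * c" by transfer (rule weyl_distrib_right)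
  show "a * (b + c) = a * b + a * c" by transfer (rule weyl_distrib_left)
  show "(0 :: ('a, 'b) weyl) \<noteq> 1" by transfer (rule weyl_nontrivial)
qed

end

lift_definition weyl_x :: "'n \<Rightarrow> ('k::field, 'n) weyl" is TX .
lift_definition weyl_y :: "'n \<Rightarrow> ('k::field, 'n) weyl" is TY .
lift_definition weyl_const :: "'k::field \<Rightarrow> ('k, 'n) weyl" is TC .

lemma weyl_const_0: "weyl_const 0 = 0"
  by transfer (rule weyl_refl)

lemma weyl_const_1: "weyl_const 1 = 1"
  by transfer (rule weyl_refl)

lemma weyl_const_add: "weyl_const (a + b) = weyl_const a + weyl_const b"
  by transfer (rule weyl_scalar_add)

lemma weyl_const_mult: "weyl_const (a * b) = weyl_const a * weyl_const b"
  by transfer (rule weyl_scalar_mul)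

lemma weyl_const_commute: "weyl_const c * a = a * weyl_const c"
  by transfer (rule weyl_scalar_central)

lemma weyl_x_commute: "weyl_x i * weyl_x j = weyl_x j * weyl_x i"
  by transfer (rule weyl_rel_xx)

lemma weyl_y_commute: "weyl_y i * weyl_y j = weyl_y j * weyl_y i"
  by transfer (rule weyl_rel_yy)

lemma weyl_x_y_commute: "i \<noteq> j \<Longrightarrow> weyl_x i * weyl_y j = weyl_y j * weyl_x i"
  by transfer (rule weyl_rel_xy_neq)

lemma weyl_x_y: "weyl_x i * weyl_y i = weyl_y i * weyl_x i + 1"
  by transfer (rule weyl_rel_xy)

lemma weyl_induct [case_names x y const uminus add mult]:
  assumes "\<And>i. P (weyl_x i)" and "\<And>i. P (weyl_y i)" and "\<And>c. P (weyl_const c)"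
    and "\<And>a. P a \<Longrightarrow> P (- a)"
    and "\<And>a b. P a \<Longrightarrow> P b \<Longrightarrow> P (a + b)" and "\<And>a b. P a \<Longrightarrow> P b \<Longrightarrow> P (a * b)"
  shows "P (a :: ('k::field, 'n) weyl)"
proof -
  have "P (abs_weyl t)" for t :: "('k, 'n) weyl_term"
  proof (induction t)
    case (TX i)
    show ?case using assms(1)[of i] by (simp only: weyl_x.abs_eq)
  next
    case (TY i)
    show ?case using assms(2)[of i] by (simp only: weyl_y.abs_eq)
  next
    case (TC c)
    show ?case using assms(3)[of c] by (simp only: weyl_const.abs_eq)
  next
    case (TNeg s)
    show ?case using assms(4)[OF TNeg] by (simp only: uminus_weyl.abs_eq)
  next
    case (TAdd s t)
    show ?case using assms(5)[OF TAdd] by (simp only: plus_weyl.abs_eq)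
  next
    case (TMul s t)
    show ?case using assms(6)[OF TMul] by (simp only: times_weyl.abs_eq)
  qed
  then show ?thesis by (induction a rule: weyl.abs_induct) simp
qed

definition weyl_scale :: "'k::field \<Rightarrow> ('k, 'n) weyl \<Rightarrow> ('k, 'n) weyl" where
  "weyl_scale c a = weyl_const c * a"

global_interpretation weyl: vector_space weyl_scale
  by unfold_locales
    (simp_all add: weyl_scale_def weyl_const_add weyl_const_mult weyl_const_1 algebra_simps)

lemma weyl_scale_mult_left: "weyl_scale c a * b = weyl_scale c (a * b)"
  by (simp add: weyl_scale_def mult.assoc)

lemma weyl_scale_mult_right: "a * weyl_scale c b = weyl_scale c (a * b)"
  unfolding weyl_scale_def by (metis mult.assoc weyl_const_commute)

primrec weyl_shift_term ::
  "('k::field) ^ ('n::finite) \<Rightarrow> ('k, 'n) weyl_term \<Rightarrow> ('k, 'n) weyl_term" where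
  "weyl_shift_term k (TX i) = TX i"
| "weyl_shift_term k (TY i) = TAdd (TY i) (TC (k $ i))"
| "weyl_shift_term k (TC c) = TC c"
| "weyl_shift_term k (TNeg s) = TNeg (weyl_shift_term k s)"
| "weyl_shift_term k (TAdd s t) = TAdd (weyl_shift_term k s) (weyl_shift_term k t)"
| "weyl_shift_term k (TMul s t) = TMul (weyl_shift_term k s) (weyl_shift_term k t)"

lemma weyl_shift_term_cong:
  "weyl_eq s t \<Longrightarrow> weyl_eq (weyl_shift_term k s) (weyl_shift_term k t)"
proof (induction rule: weyl_eq.induct)
  case (weyl_trans s t u)
  then show ?case by (blast intro: weyl_eq.weyl_trans)
next
  case (weyl_sym s t)
  then show ?case by (blast intro: weyl_eq.weyl_sym)
next
  case (weyl_rel_yy i j)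
  have "(weyl_y i + weyl_const (k $ i)) * (weyl_y j + weyl_const (k $ j)) =
        (weyl_y j + weyl_const (k $ j)) * (weyl_y i + weyl_const (k $ i))"
    by (simp add: algebra_simps weyl_y_commute[of i j] weyl_const_commute[of "k $ i" "weyl_y j"]
        weyl_const_commute[of "k $ j" "weyl_y i"]
        weyl_const_commute[of "k $ j" "weyl_const (k $ i)"])
  then show ?case by transfer simp
next
  case (weyl_rel_xy_neq i j)
  then have "weyl_x i * (weyl_y j + weyl_const (k $ j)) =
        (weyl_y j + weyl_const (k $ j)) * weyl_x i"
    using weyl_const_commute[of "k $ j" "weyl_x i"]
    by (simp add: algebra_simps weyl_x_y_commute[of i j])
  then show ?case by transfer simp
next
  case (weyl_rel_xy i)
  have "weyl_x i * (weyl_y i + weyl_const (k $ i)) =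
        (weyl_y i + weyl_const (k $ i)) * weyl_x i + 1"
    using weyl_const_commute[of "k $ i" "weyl_x i"]
    by (simp add: algebra_simps weyl_x_y)
  then show ?case by transfer simp
qed (unfold weyl_shift_term.simps, (rule weyl_eq.intros; assumption)+)

lift_definition weyl_shift :: "('k::field) ^ ('n::finite) \<Rightarrow> ('k, 'n) weyl \<Rightarrow> ('k, 'n) weyl"
  is weyl_shift_term
  by (rule weyl_shift_term_cong)

definition weyl_endomorphism :: "(('k::field, 'n) weyl \<Rightarrow> ('k, 'n) weyl) \<Rightarrow> bool" where
  "weyl_endomorphism f \<longleftrightarrow>
     Vector_Spaces.linear weyl_scale weyl_scale f \<and> f 1 = 1 \<and> (\<forall>a b. f (a * b) = f a * f b)"

lemma weyl_shift_x: "weyl_shift k (weyl_x i) = weyl_x i"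
  by transfer (simp add: weyl_refl)

lemma weyl_shift_y: "weyl_shift k (weyl_y i) = weyl_y i + weyl_const (k $ i)"
  by transfer (simp add: weyl_refl)

lemma weyl_shift_const: "weyl_shift k (weyl_const c) = weyl_const c"
  by transfer (simp add: weyl_refl)

lemma weyl_shift_uminus: "weyl_shift k (- a) = - weyl_shift k a"
  by transfer (simp add: weyl_refl)

lemma weyl_shift_add: "weyl_shift k (a + b) = weyl_shift k a + weyl_shift k b"
  by transfer (simp add: weyl_refl)

lemma weyl_shift_mult: "weyl_shift k (a * b) = weyl_shift k a * weyl_shift k b"
  by transfer (simp add: weyl_refl)

lemma weyl_shift_scale: "weyl_shift k (weyl_scale c a) = weyl_scale c (weyl_shift k a)"
  by (simp add: weyl_scale_def weyl_shift_mult weyl_shift_const)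

lemma weyl_endomorphism_weyl_shift: "weyl_endomorphism (weyl_shift k)"
  unfolding weyl_endomorphism_def
proof (intro conjI allI)
  show "Vector_Spaces.linear weyl_scale weyl_scale (weyl_shift k)"
    by unfold_locales (simp_all add: weyl_shift_add weyl_shift_scale)
  show "weyl_shift k 1 = 1"
    using weyl_shift_const[of k 1] by (simp add: weyl_const_1)
qed (rule weyl_shift_mult)

lemma weyl_shift_uminus_weyl_shift: "weyl_shift (- k) (weyl_shift k a) = a"
proof (induction a rule: weyl_induct)
  case (y i)
  have "weyl_const (- (k $ i)) + weyl_const (k $ i) = (0 :: ('a, 'b) weyl)"
    by (simp add: weyl_const_add[symmetric] weyl_const_0)
  then show ?case
    by (simp add: weyl_shift_y weyl_shift_add weyl_shift_const add.assoc)
qed (simp_all add: weyl_shift_x weyl_shift_const weyl_shift_uminus weyl_shift_add weyl_shift_mult)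

lemma bij_weyl_shift: "bij (weyl_shift k)"
  by (rule bij_betw_byWitness[where f' = "weyl_shift (- k)"])
    (use weyl_shift_uminus_weyl_shift[of k] weyl_shift_uminus_weyl_shift[of "- k"] in auto)

text \<open>So \<^const>\<open>weyl_shift\<close> is the unique algebra endomorphism with the prescribed values on the
  generators, and it is an automorphism.\<close>

lemma weyl_shift_unique:
  assumes f: "weyl_endomorphism f"
    and "\<And>i. f (weyl_x i) = weyl_x i" and "\<And>i. f (weyl_y i) = weyl_y i + weyl_const (k $ i)"
  shows "f = weyl_shift k"
proof
  interpret f: Vector_Spaces.linear weyl_scale weyl_scale f
    using f by (simp add: weyl_endomorphism_def)
  fix a
  show "f a = weyl_shift k a"
  proof (induction a rule: weyl_induct)
    case (const c)
    have "f (weyl_scale c 1) = weyl_scale c 1"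
      using f f.scale[of c 1] by (simp add: weyl_endomorphism_def)
    then show ?case by (simp add: weyl_scale_def weyl_shift_const)
  next
    case (mult a b)
    then show ?case using f by (simp add: weyl_endomorphism_def weyl_shift_mult)
  qed (simp_all add: assms weyl_shift_x weyl_shift_y weyl_shift_uminus weyl_shift_add f.add f.neg)
qed

definition hom_weyl_mult ::
  "('k::field) ^ ('n::finite) \<Rightarrow> ('k, 'n) weyl \<Rightarrow> ('k, 'n) weyl \<Rightarrow> ('k, 'n) weyl" where
  "hom_weyl_mult k a b = weyl_shift k (a * b)"

definition hom_weyl_left_ideal ::
  "('k::field) ^ ('n::finite) \<Rightarrow> ('k, 'n) weyl set \<Rightarrow> bool" where
  "hom_weyl_left_ideal k I \<longleftrightarrow> weyl.subspace I \<and> (\<forall>a. \<forall>q\<in>I. hom_weyl_mult k a q \<in> I)"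

definition hom_weyl_right_ideal ::
  "('k::field) ^ ('n::finite) \<Rightarrow> ('k, 'n) weyl set \<Rightarrow> bool" where
  "hom_weyl_right_ideal k I \<longleftrightarrow> weyl.subspace I \<and> (\<forall>a. \<forall>q\<in>I. hom_weyl_mult k q a \<in> I)"

text \<open>Both kinds of ideals are closed under intersections, so the hulls below are the smallest ideals
  containing a given set.\<close>

lemma hom_weyl_left_ideal_Inter:
  "(\<And>I. I \<in> F \<Longrightarrow> hom_weyl_left_ideal k I) \<Longrightarrow> hom_weyl_left_ideal k (\<Inter>F)"
  unfolding hom_weyl_left_ideal_def by (auto intro!: weyl.subspace_Inter)

lemma hom_weyl_right_ideal_Inter:
  "(\<And>I. I \<in> F \<Longrightarrow> hom_weyl_right_ideal k I) \<Longrightarrow> hom_weyl_right_ideal k (\<Inter>F)"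
  unfolding hom_weyl_right_ideal_def by (auto intro!: weyl.subspace_Inter)

definition hom_weyl_principal_left ::
  "('k::field) ^ ('n::finite) \<Rightarrow> ('k, 'n) weyl set \<Rightarrow> bool" where
  "hom_weyl_principal_left k I \<longleftrightarrow> (\<exists>p. I = hom_weyl_left_ideal k hull {p})"

definition hom_weyl_principal_right ::
  "('k::field) ^ ('n::finite) \<Rightarrow> ('k, 'n) weyl set \<Rightarrow> bool" where
  "hom_weyl_principal_right k I \<longleftrightarrow> (\<exists>p. I = hom_weyl_right_ideal k hull {p})"

end

theory Submission
  imports Defs
begin

text \<open>Let \<open>\<Delta> = \<alpha>\<^sub>k - 1\<close>, which is locally nilpotent. The left ideals of the twisted algebra are
  therefore exactly the \<open>\<Delta>\<close>-stable left ideals of \<open>A\<^sub>n\<close>. With \<open>t = y\<^sub>i / k\<^sub>i\<close> the binomial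
  polynomials \<open>b\<^sub>j\<close> in \<open>t\<close> satisfy \<open>\<Delta> b\<^sub>j\<^sub>+\<^sub>1 = b\<^sub>j\<close>, so every element of such an ideal \<open>I\<close> has the
  form \<open>\<Sum>\<^sub>j b\<^sub>j c\<^sub>j\<close> with \<open>c\<^sub>j \<in> I\<close> killed by \<open>\<Delta>\<close>. Since \<open>A\<^sub>n\<close> is left Noetherian, \<open>I\<close> is generated
  by finitely many such constants \<open>c\<^sub>0, \<dots>, c\<^sub>r\<close>, and these can be recovered from the single element
  \<open>\<Sum>\<^sub>j b\<^sub>j c\<^sub>j\<close> by applying powers of \<open>\<Delta>\<close>. The anti-automorphism with \<open>x\<^sub>i \<mapsto> x\<^sub>i\<close> and
  \<open>y\<^sub>i \<mapsto> - y\<^sub>i\<close> turns right ideals for \<open>k\<close> into left ideals for \<open>- k\<close>.\<close>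

section \<open>A Hilbert basis theorem\<close>

text \<open>Subrings are sets inside one ambient ring, so that the coefficient ring can grow by one
  generator at a time. Closure under differences, together with 1, yields zero, negatives and
  sums.\<close>

definition subring_set :: "'a::ring_1 set \<Rightarrow> bool" where
  "subring_set S \<longleftrightarrow> 1 \<in> S \<and> (\<forall>a\<in>S. \<forall>b\<in>S. a - b \<in> S \<and> a * b \<in> S)"

definition left_submodule :: "'a::ring_1 set \<Rightarrow> 'a set \<Rightarrow> bool" where
  "left_submodule S M \<longleftrightarrow> 0 \<in> M \<and> (\<forall>a\<in>M. \<forall>b\<in>M. a + b \<in> M) \<and> (\<forall>s\<in>S. \<forall>a\<in>M. s * a \<in> M)"

definition left_noetherian :: "'a::ring_1 set \<Rightarrow> bool" where
  "left_noetherian S \<longleftrightarrow>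
     (\<forall>M\<subseteq>S. left_submodule S M \<longrightarrow> (\<exists>F. finite F \<and> M = left_submodule S hull F))"

lemma subring_setI:
  assumes "1 \<in> S" and "\<And>a b. a \<in> S \<Longrightarrow> b \<in> S \<Longrightarrow> a - b \<in> S"
    and "\<And>a b. a \<in> S \<Longrightarrow> b \<in> S \<Longrightarrow> a * b \<in> S"
  shows "subring_set S"
  using assms by (auto simp: subring_set_def)

lemma left_submoduleI:
  assumes "0 \<in> M" and "\<And>a b. a \<in> M \<Longrightarrow> b \<in> M \<Longrightarrow> a + b \<in> M"
    and "\<And>s a. s \<in> S \<Longrightarrow> a \<in> M \<Longrightarrow> s * a \<in> M"
  shows "left_submodule S M"
  using assms by (auto simp: left_submodule_def)

lemma left_noetherianD:
  assumes "left_noetherian S" "M \<subseteq> S" "left_submodule S M"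
  obtains F where "finite F" "M = left_submodule S hull F"
  using assms by (auto simp: left_noetherian_def)

lemma subring_set_one: "subring_set S \<Longrightarrow> 1 \<in> S"
  and subring_set_diff: "subring_set S \<Longrightarrow> a \<in> S \<Longrightarrow> b \<in> S \<Longrightarrow> a - b \<in> S"
  and subring_set_mult: "subring_set S \<Longrightarrow> a \<in> S \<Longrightarrow> b \<in> S \<Longrightarrow> a * b \<in> S"
  by (auto simp: subring_set_def)

lemma subring_set_zero: "subring_set S \<Longrightarrow> 0 \<in> S"
  using subring_set_diff[of S 1 1] subring_set_one[of S] by simp

lemma subring_set_uminus: "subring_set S \<Longrightarrow> a \<in> S \<Longrightarrow> - a \<in> S"
  using subring_set_diff[of S 0 a] subring_set_zero[of S] by simp

lemma subring_set_add: "subring_set S \<Longrightarrow> a \<in> S \<Longrightarrow> b \<in> S \<Longrightarrow> a + b \<in> S"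
  using subring_set_diff[of S a "- b"] subring_set_uminus[of S b] by simp

lemmas subring_set_intros =
  subring_set_one subring_set_zero subring_set_uminus subring_set_add subring_set_diff subring_set_mult

lemma subring_set_hull: "subring_set (subring_set hull G)"
  by (rule hull_in) (auto simp: subring_set_def)

lemma left_submodule_zero: "left_submodule S M \<Longrightarrow> 0 \<in> M"
  and left_submodule_add: "left_submodule S M \<Longrightarrow> a \<in> M \<Longrightarrow> b \<in> M \<Longrightarrow> a + b \<in> M"
  and left_submodule_mult: "left_submodule S M \<Longrightarrow> s \<in> S \<Longrightarrow> a \<in> M \<Longrightarrow> s * a \<in> M"
  by (auto simp: left_submodule_def)

lemma left_submodule_uminus:
  assumes "subring_set S" "left_submodule S M" "a \<in> M"
  shows "- a \<in> M"
  using left_submodule_mult[OF assms(2) subring_set_uminus[OF assms(1) subring_set_one] assms(3)]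
    assms(1) by simp

lemma left_submodule_diff:
  assumes "subring_set S" "left_submodule S M" "a \<in> M" "b \<in> M"
  shows "a - b \<in> M"
  using left_submodule_add[OF assms(2,3) left_submodule_uminus[OF assms(1,2,4)]] by simp

lemma left_submodule_hull: "left_submodule S (left_submodule S hull F)"
  by (rule hull_in) (auto simp: left_submodule_def)

text \<open>Representations as polynomials in \<open>z\<close> over \<open>S\<close> are not assumed to be unique.\<close>

locale almost_centralizing_extension =
  fixes S :: "'a::ring_1 set" and z :: 'a
  assumes subring: "subring_set S"
    and commutator: "s \<in> S \<Longrightarrow> z * s - s * z \<in> S"
begin

primrec degree_lt :: "nat \<Rightarrow> 'a set" where
  "degree_lt 0 = {0}"
| "degree_lt (Suc m) = {s * z ^ m + r | s r. s \<in> S \<and> r \<in> degree_lt m}"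

definition extension :: "'a set" where
  "extension = (\<Union>m. degree_lt m)"

text \<open>An element may have several representations, so a coefficient counts as soon as some
  representation has it in front of \<open>z ^ m\<close>. Zero is allowed, which makes the set a
  left ideal of \<open>S\<close>.\<close>

definition leading_coeffs :: "'a set \<Rightarrow> nat \<Rightarrow> 'a set" where
  "leading_coeffs L m = {s \<in> S. \<exists>r\<in>degree_lt m. s * z ^ m + r \<in> L}"

lemma degree_ltI: "s \<in> S \<Longrightarrow> r \<in> degree_lt m \<Longrightarrow> s * z ^ m + r \<in> degree_lt (Suc m)"
  by auto

lemma degree_lt_zero: "0 \<in> degree_lt m"
proof (induction m)
  case (Suc m)
  then show ?case using degree_ltI[of 0 0 m] subring_set_zero[OF subring] by simp
qed simp

lemma degree_lt_Suc: "r \<in> degree_lt m \<Longrightarrow> r \<in> degree_lt (Suc m)"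
  using degree_ltI[of 0 r m] subring_set_zero[OF subring] by simp

lemma degree_lt_mono: "m \<le> l \<Longrightarrow> degree_lt m \<subseteq> degree_lt l"
  by (rule lift_Suc_mono_le[of degree_lt]) (blast intro: degree_lt_Suc)

lemma degree_lt_add: "a \<in> degree_lt m \<Longrightarrow> b \<in> degree_lt m \<Longrightarrow> a + b \<in> degree_lt m"
proof (induction m arbitrary: a b)
  case (Suc m)
  from Suc.prems obtain s r s' r' where
    "a = s * z ^ m + r" "s \<in> S" "r \<in> degree_lt m" "b = s' * z ^ m + r'" "s' \<in> S" "r' \<in> degree_lt m"
    by auto
  moreover from this have "(s + s') * z ^ m + (r + r') \<in> degree_lt (Suc m)"
    by (intro degree_ltI Suc.IH subring_set_add[OF subring])
  ultimately show ?case by (simp only: algebra_simps)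
qed simp

lemma degree_lt_mult: "s \<in> S \<Longrightarrow> a \<in> degree_lt m \<Longrightarrow> s * a \<in> degree_lt m"
proof (induction m arbitrary: a)
  case (Suc m)
  from Suc.prems obtain s' r where
    a: "a = s' * z ^ m + r" "s' \<in> S" "r \<in> degree_lt m"
    by auto
  have "(s * s') * z ^ m + s * r \<in> degree_lt (Suc m)"
    using a Suc by (intro degree_ltI Suc.IH subring_set_mult[OF subring])
  then show ?case using a by (simp only: algebra_simps)
qed simp

lemma degree_lt_uminus: "a \<in> degree_lt m \<Longrightarrow> - a \<in> degree_lt m"
  using degree_lt_mult[OF subring_set_uminus[OF subring subring_set_one[OF subring]]] by simp

text \<open>Moving \<open>z\<close> past \<open>s\<close> costs only a commutator, which lies in
  \<open>S\<close> and enters in degree \<open>m\<close>. Left multiplication by \<open>z\<close>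
  therefore raises the degree and keeps the leading coefficient.\<close>

lemma leading_term_times:
  "z * (s * z ^ m + r) = s * z ^ Suc m + ((z * s - s * z) * z ^ m + z * r)"
  by (simp add: algebra_simps)

lemma degree_lt_times: "a \<in> degree_lt m \<Longrightarrow> z * a \<in> degree_lt (Suc m)"
proof (induction m arbitrary: a)
  case 0
  then show ?case using degree_lt_zero[of 1] by simp
next
  case (Suc m)
  from Suc.prems obtain s r where
    a: "a = s * z ^ m + r" "s \<in> S" "r \<in> degree_lt m"
    by auto
  have "(z * s - s * z) * z ^ m + z * r \<in> degree_lt (Suc m)"
    by (intro degree_lt_add degree_lt_Suc[of "z * r"] Suc.IH a)
      (use degree_ltI[OF commutator[OF a(2)] degree_lt_zero[of m]] Suc.IH[OF a(3)] in auto)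
  then show ?case using a degree_ltI[of s _ "Suc m"] by (simp only: leading_term_times)
qed

lemma extension_add: "a \<in> extension \<Longrightarrow> b \<in> extension \<Longrightarrow> a + b \<in> extension"
proof -
  assume "a \<in> extension" "b \<in> extension"
  then obtain m l where "a \<in> degree_lt m" "b \<in> degree_lt l" by (auto simp: extension_def)
  then have "a \<in> degree_lt (max m l)" "b \<in> degree_lt (max m l)"
    using degree_lt_mono[of m "max m l"] degree_lt_mono[of l "max m l"] by auto
  then show ?thesis unfolding extension_def by (blast intro: degree_lt_add)
qed

lemma extension_times: "a \<in> extension \<Longrightarrow> z * a \<in> extension"
  unfolding extension_def by (blast intro: degree_lt_times)

lemma extension_power_times: "a \<in> extension \<Longrightarrow> z ^ m * a \<in> extension"
  by (induction m) (simp_all add: mult.assoc extension_times)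

lemma extension_scale: "s \<in> S \<Longrightarrow> a \<in> extension \<Longrightarrow> s * a \<in> extension"
  unfolding extension_def by (blast intro: degree_lt_mult)

text \<open>Expanding the left factor as \<open>s * z ^ m + r\<close> leaves only left
  multiplications by \<open>z\<close> and by elements of \<open>S\<close>, so \<open>b\<close>
  itself need not be expanded.\<close>

lemma extension_mult:
  assumes "a \<in> extension" "b \<in> extension"
  shows "a * b \<in> extension"
proof -
  have "a * b \<in> extension" if "a \<in> degree_lt m" for m
    using that
  proof (induction m arbitrary: a)
    case 0
    then show ?case using degree_lt_zero by (auto simp: extension_def)
  next
    case (Suc m)
    then obtain s r where a: "a = s * z ^ m + r" "s \<in> S" "r \<in> degree_lt m" by auto
    then show ?case
      using extension_add[OF extension_scale[OF a(2) extension_power_times[OF assms(2), of m]] Suc.IH]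
      by (simp add: algebra_simps)
  qed
  then show ?thesis using assms(1) by (auto simp: extension_def)
qed

lemma subset_extension: "S \<subseteq> extension"
proof
  fix s assume "s \<in> S"
  then have "s \<in> degree_lt 1" using degree_ltI[of s 0 0] by simp
  then show "s \<in> extension" unfolding extension_def by blast
qed

lemma variable_in_extension: "z \<in> extension"
  using extension_times[of 1] subset_extension subring_set_one[OF subring] by auto

lemma subring_extension: "subring_set extension"
proof -
  have "- b \<in> extension" if "b \<in> extension" for b
    using that degree_lt_uminus unfolding extension_def by blast
  then show ?thesis
    unfolding subring_set_def
    using subset_extension subring_set_one[OF subring] extension_mult
    by (metis extension_add diff_conv_add_uminus subsetD)
qed

lemma left_submodule_leading_coeffs:
  assumes L: "left_submodule extension L"
  shows "left_submodule S (leading_coeffs L m)"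
proof (rule left_submoduleI)
  show "0 \<in> leading_coeffs L m"
    using degree_lt_zero[of m] left_submodule_zero[OF L] subring_set_zero[OF subring]
    by (force simp: leading_coeffs_def)
next
  fix a b assume "a \<in> leading_coeffs L m" "b \<in> leading_coeffs L m"
  then obtain r r' where ab: "a \<in> S" "b \<in> S" "r \<in> degree_lt m" "r' \<in> degree_lt m"
    and "a * z ^ m + r \<in> L" "b * z ^ m + r' \<in> L"
    by (auto simp: leading_coeffs_def)
  then have "(a * z ^ m + r) + (b * z ^ m + r') \<in> L" by (blast intro: left_submodule_add[OF L])
  then have "(a + b) * z ^ m + (r + r') \<in> L" by (simp only: algebra_simps)
  then show "a + b \<in> leading_coeffs L m"
    using ab degree_lt_add subring_set_add[OF subring] unfolding leading_coeffs_def by blast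
next
  fix s a assume s: "s \<in> S" and "a \<in> leading_coeffs L m"
  then obtain r where a: "a \<in> S" "r \<in> degree_lt m" "a * z ^ m + r \<in> L"
    by (auto simp: leading_coeffs_def)
  then have "s * (a * z ^ m + r) \<in> L" using s subset_extension by (blast intro: left_submodule_mult[OF L])
  then have "(s * a) * z ^ m + s * r \<in> L" by (simp only: algebra_simps)
  then show "s * a \<in> leading_coeffs L m"
    using s a degree_lt_mult subring_set_mult[OF subring] unfolding leading_coeffs_def by blast
qed

text \<open>Multiply a witness by \<open>z\<close> from the left: by
  \<open>leading_term_times\<close> the leading coefficient survives and the rest has degree at most
  \<open>m\<close>.\<close>

lemma leading_coeffs_Suc:
  assumes L: "left_submodule extension L"
  shows "leading_coeffs L m \<subseteq> leading_coeffs L (Suc m)"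
proof
  fix s assume "s \<in> leading_coeffs L m"
  then obtain r where s: "s \<in> S" "r \<in> degree_lt m" "s * z ^ m + r \<in> L"
    by (auto simp: leading_coeffs_def)
  have "z * (s * z ^ m + r) \<in> L"
    by (rule left_submodule_mult[OF L variable_in_extension s(3)])
  moreover have "(z * s - s * z) * z ^ m + z * r \<in> degree_lt (Suc m)"
    by (intro degree_lt_add degree_lt_times s)
      (use degree_ltI[OF commutator[OF s(1)] degree_lt_zero[of m]] in simp)
  ultimately show "s \<in> leading_coeffs L (Suc m)"
    using s(1) unfolding leading_coeffs_def leading_term_times by blast
qed

lemma leading_coeffs_le:
  "left_submodule extension L \<Longrightarrow> m \<le> l \<Longrightarrow> leading_coeffs L m \<subseteq> leading_coeffs L l"
  by (rule lift_Suc_mono_le[of "leading_coeffs L"]) (rule leading_coeffs_Suc)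

text \<open>Division without uniqueness: subtracting an element of \<open>J\<close> with the same
  leading term leaves an element of \<open>L\<close> with a smaller degree bound.\<close>

lemma subset_of_leading_coeffs_subset:
  assumes J: "left_submodule extension J" and L: "left_submodule extension L" "L \<subseteq> extension"
    and "J \<subseteq> L" and lead: "\<And>m. leading_coeffs L m \<subseteq> leading_coeffs J m"
  shows "L \<subseteq> J"
proof -
  have "a \<in> J" if "a \<in> L" "a \<in> degree_lt m" for a m
    using that
  proof (induction m arbitrary: a)
    case 0
    then show ?case using left_submodule_zero[OF J] by simp
  next
    case (Suc m)
    then obtain s r where a: "a = s * z ^ m + r" "s \<in> S" "r \<in> degree_lt m" by auto
    then have "s \<in> leading_coeffs L m" using Suc.prems by (auto simp: leading_coeffs_def)
    then obtain r' where r': "r' \<in> degree_lt m" "s * z ^ m + r' \<in> J"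
      using lead by (auto simp: leading_coeffs_def)
    have "a - (s * z ^ m + r') \<in> L"
      using Suc.prems r' \<open>J \<subseteq> L\<close> by (intro left_submodule_diff[OF subring_extension L(1)]) auto
    then have "r + - r' \<in> L" by (simp add: a)
    then have "r + - r' \<in> J"
      by (rule Suc.IH) (intro degree_lt_add degree_lt_uminus a r')
    then have "r + - r' + (s * z ^ m + r') \<in> J"
      using r'(2) by (rule left_submodule_add[OF J])
    then show ?case by (simp add: a algebra_simps)
  qed
  then show ?thesis using L(2) by (auto simp: extension_def)
qed

text \<open>Hilbert's argument. The increasing leading coefficient ideals become stationary at some
  \<open>N\<close>, because their union is finitely generated; lifts of finitely many generators in
  each degree up to \<open>N\<close> generate \<open>L\<close>.\<close>

theorem left_noetherian_extension:
  assumes noeth: "left_noetherian S"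
  shows "left_noetherian extension"
  unfolding left_noetherian_def
proof (intro allI impI)
  fix L assume L: "L \<subseteq> extension" "left_submodule extension L"
  note lead = left_submodule_leading_coeffs[OF L(2)]
  let ?U = "\<Union>m. leading_coeffs L m"
  have "left_submodule S ?U"
  proof (rule left_submoduleI)
    show "0 \<in> ?U" using left_submodule_zero[OF lead] by blast
  next
    fix a b assume "a \<in> ?U" "b \<in> ?U"
    then obtain m l where "a \<in> leading_coeffs L m" "b \<in> leading_coeffs L l" by blast
    then have "a \<in> leading_coeffs L (max m l)" "b \<in> leading_coeffs L (max m l)"
      using leading_coeffs_le[OF L(2), of m "max m l"] leading_coeffs_le[OF L(2), of l "max m l"]
      by auto
    then show "a + b \<in> ?U" using left_submodule_add[OF lead] by blast
  next
    fix s a assume "s \<in> S" "a \<in> ?U"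
    then show "s * a \<in> ?U" using left_submodule_mult[OF lead] by blast
  qed
  moreover have "?U \<subseteq> S" by (auto simp: leading_coeffs_def)
  ultimately obtain F where F: "finite F" "?U = left_submodule S hull F"
    by (meson left_noetherianD[OF noeth])
  have "\<forall>f\<in>F. \<exists>m. f \<in> leading_coeffs L m"
    using hull_subset[of F "left_submodule S"] F(2) by blast
  then obtain d where d: "\<And>f. f \<in> F \<Longrightarrow> f \<in> leading_coeffs L (d f)" by metis
  \<comment> \<open>The inserted 0 keeps \<open>Max\<close> meaningful when \<open>F\<close> is
    empty.\<close>
  define N where "N = Max (insert 0 (d ` F))"
  have "F \<subseteq> leading_coeffs L N"
  proof
    fix f assume "f \<in> F"
    moreover from this have "d f \<le> N" using F(1) by (auto simp: N_def)
    ultimately show "f \<in> leading_coeffs L N" using d leading_coeffs_le[OF L(2)] by blast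
  qed
  then have stable: "leading_coeffs L m \<subseteq> leading_coeffs L N" for m
    using F(2) hull_minimal[of F "leading_coeffs L N" "left_submodule S"] lead by blast
  have "\<exists>F. finite F \<and> leading_coeffs L m = left_submodule S hull F" for m
  proof -
    have "leading_coeffs L m \<subseteq> S" by (auto simp: leading_coeffs_def)
    from left_noetherianD[OF noeth this lead] show ?thesis by metis
  qed
  then obtain E where E: "\<And>m. finite (E m)" "\<And>m. leading_coeffs L m = left_submodule S hull E m"
    by metis
  have "\<forall>m. \<forall>s\<in>leading_coeffs L m. \<exists>g\<in>L. \<exists>r\<in>degree_lt m. g = s * z ^ m + r"
    by (auto simp: leading_coeffs_def)
  then obtain g where g: "\<And>m s. s \<in> leading_coeffs L m \<Longrightarrow> g m s \<in> L"
    "\<And>m s. s \<in> leading_coeffs L m \<Longrightarrow> \<exists>r\<in>degree_lt m. g m s = s * z ^ m + r"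
    by metis
  have E_sub: "E m \<subseteq> leading_coeffs L m" for m
    using E(2)[of m] hull_subset[of "E m" "left_submodule S"] by simp
  \<comment> \<open>Each \<open>g m e\<close> is an element of \<open>L\<close> with leading term
    \<open>e * z ^ m\<close>.\<close>
  define G where "G = (\<Union>m\<le>N. g m ` E m)"
  let ?J = "left_submodule extension hull G"
  have "finite G" unfolding G_def using E(1) by auto
  have "G \<subseteq> L" unfolding G_def using g(1) E_sub by blast
  then have JL: "?J \<subseteq> L" using L(2) by (rule hull_minimal)
  have low: "leading_coeffs L m \<subseteq> leading_coeffs ?J m" if "m \<le> N" for m
  proof -
    have "E m \<subseteq> leading_coeffs ?J m"
    proof
      fix e assume e: "e \<in> E m"
      then obtain r where "r \<in> degree_lt m" "g m e = e * z ^ m + r" using g(2) E_sub by blast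
      moreover have "g m e \<in> ?J" using e that by (intro hull_inc) (auto simp: G_def)
      moreover have "e \<in> S" using e E_sub by (auto simp: leading_coeffs_def)
      ultimately show "e \<in> leading_coeffs ?J m" unfolding leading_coeffs_def by auto
    qed
    then show ?thesis
      unfolding E(2)[of m]
      by (rule hull_minimal) (rule left_submodule_leading_coeffs[OF left_submodule_hull])
  qed
  \<comment> \<open>Above \<open>N\<close> nothing new appears in \<open>L\<close>, and
    multiplication by powers of \<open>z\<close> carries the coefficients of \<open>?J\<close>
    upwards.\<close>
  have "leading_coeffs L m \<subseteq> leading_coeffs ?J m" for m
  proof (cases "m \<le> N")
    case False
    then have "leading_coeffs ?J N \<subseteq> leading_coeffs ?J m"
      by (intro leading_coeffs_le left_submodule_hull) simp
    then show ?thesis using stable[of m] low[of N] by blast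
  qed (rule low)
  then have "L \<subseteq> ?J"
    by (rule subset_of_leading_coeffs_subset[OF left_submodule_hull L(2,1) JL])
  with JL \<open>finite G\<close> show "\<exists>F. finite F \<and> L = left_submodule extension hull F" by blast
qed

end

text \<open>Commutators need checking on generators only: the commutator with \<open>z\<close> is a
  derivation, so the elements that it maps into the subring form a subring themselves.\<close>

lemma left_noetherian_hull_insert:
  fixes G :: "'a::ring_1 set"
  assumes noeth: "left_noetherian (subring_set hull G)"
    and comm: "\<And>g. g \<in> G \<Longrightarrow> z * g - g * z \<in> subring_set hull G"
  shows "left_noetherian (subring_set hull (insert z G))"
proof -
  let ?S = "subring_set hull G"
  have S: "subring_set ?S" by (rule subring_set_hull)
  have "subring_set {s \<in> ?S. z * s - s * z \<in> ?S}" (is "subring_set ?T")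
  proof (rule subring_setI)
    show "1 \<in> ?T" by (auto intro: subring_set_intros[OF S])
  next
    fix a b assume ab: "a \<in> ?T" "b \<in> ?T"
    have "z * (a - b) - (a - b) * z = (z * a - a * z) - (z * b - b * z)" by (simp add: algebra_simps)
    then show "a - b \<in> ?T" using ab by (auto intro: subring_set_intros[OF S])
    have "z * (a * b) - (a * b) * z = (z * a - a * z) * b + a * (z * b - b * z)"
      by (simp add: algebra_simps)
    then show "a * b \<in> ?T" using ab by (auto intro: subring_set_intros[OF S])
  qed
  moreover have "G \<subseteq> ?T" using comm by (auto intro: hull_inc)
  ultimately have T: "?S \<subseteq> ?T" by (intro hull_minimal)
  interpret almost_centralizing_extension ?S z
    by unfold_locales (use S T in auto)
  have "subring_set hull (insert z G) = extension"
  proof (rule hull_unique)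
    show "insert z G \<subseteq> extension"
      using variable_in_extension subset_extension hull_subset[of G subring_set] by blast
    show "subring_set extension" by (rule subring_extension)
    fix T' assume T': "insert z G \<subseteq> T'" "subring_set T'"
    then have S_T': "?S \<subseteq> T'" by (intro hull_minimal) auto
    have pow: "z ^ m \<in> T'" for m
      using T' by (induction m) (auto intro: subring_set_intros)
    have "degree_lt m \<subseteq> T'" for m
      by (induction m) (use T' pow S_T' in \<open>auto intro!: subring_set_intros\<close>)
    then show "extension \<subseteq> T'" unfolding extension_def by blast
  qed
  then show ?thesis using left_noetherian_extension[OF noeth] by simp
qed

section \<open>The Weyl algebra is left Noetherian\<close>

lemma weyl_const_uminus: "weyl_const (- c) = - weyl_const c"
  using weyl_const_add[of "- c" c] by (simp add: weyl_const_0 eq_neg_iff_add_eq_0)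

lemma subring_set_range_weyl_const: "subring_set (range weyl_const)"
proof (rule subring_setI)
  show "1 \<in> range weyl_const" by (metis weyl_const_1 rangeI)
next
  fix a b :: "('a, 'b) weyl" assume "a \<in> range weyl_const" "b \<in> range weyl_const"
  then obtain c d where "a = weyl_const c" "b = weyl_const d" by blast
  then have "a - b = weyl_const (c + - d)" "a * b = weyl_const (c * d)"
    by (simp_all only: weyl_const_add weyl_const_uminus weyl_const_mult diff_conv_add_uminus)
  then show "a - b \<in> range weyl_const" "a * b \<in> range weyl_const" by blast+
qed

text \<open>The scalars come from a field, so a nonzero submodule contains an invertible scalar and
  is everything.\<close>

lemma left_noetherian_range_weyl_const: "left_noetherian (range weyl_const)"
  unfolding left_noetherian_def
proof (intro allI impI)
  fix M :: "('a, 'b) weyl set"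
  let ?K = "range weyl_const :: ('a, 'b) weyl set"
  assume M: "M \<subseteq> ?K" "left_submodule ?K M"
  show "\<exists>F. finite F \<and> M = left_submodule ?K hull F"
  proof (cases "M \<subseteq> {0}")
    case True
    then have "M = left_submodule ?K hull {}"
      using left_submodule_zero[OF left_submodule_hull] left_submodule_zero[OF M(2)]
        hull_minimal[of "{}" M "left_submodule ?K"] M(2) by blast
    then show ?thesis by blast
  next
    case False
    then obtain c where c: "weyl_const c \<in> M" "weyl_const c \<noteq> (0 :: ('a, 'b) weyl)"
      using M(1) by blast
    then have "c \<noteq> 0" by (auto simp: weyl_const_0)
    have gen: "?K \<subseteq> left_submodule ?K hull {weyl_const c}"
    proof
      fix a :: "('a, 'b) weyl" assume "a \<in> ?K"
      then obtain d where "a = weyl_const d" by blast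
      then have "a = weyl_const (d / c) * weyl_const c"
        using \<open>c \<noteq> 0\<close> by (simp add: weyl_const_mult[symmetric])
      moreover have "weyl_const (d / c) * weyl_const c \<in> left_submodule ?K hull {weyl_const c}"
        by (intro left_submodule_mult[OF left_submodule_hull] hull_inc) auto
      ultimately show "a \<in> left_submodule ?K hull {weyl_const c}" by simp
    qed
    have "left_submodule ?K hull {weyl_const c} \<subseteq> M"
      by (rule hull_minimal) (use c M in auto)
    then have "M = left_submodule ?K hull {weyl_const c}" using gen M(1) by blast
    then show ?thesis by blast
  qed
qed

text \<open>Starting from the scalars, adjoin the \<open>weyl_y i\<close>, which commute with
  everything present, and then the \<open>weyl_x i\<close>, whose commutators with the earlier
  generators are 0 or 1.\<close>

lemma left_noetherian_weyl: "left_noetherian (UNIV :: ('k::field, 'n::finite) weyl set)"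
proof -
  define K where "K = (range weyl_const :: ('k, 'n) weyl set)"
  let ?gen = "\<lambda>G :: ('k, 'n) weyl set. subring_set hull (K \<union> G)"
  have gen_0: "0 \<in> ?gen G" and gen_1: "1 \<in> ?gen G" for G
    by (simp_all add: subring_set_intros subring_set_hull)
  have K_comm: "z * a - a * z = 0" if "a \<in> K" for z a
    using that by (auto simp: K_def weyl_const_commute)
  have "?gen {} = K"
    by (simp add: hull_same K_def subring_set_range_weyl_const)
  then have base: "left_noetherian (?gen {})"
    by (simp add: K_def left_noetherian_range_weyl_const)
  have ys: "left_noetherian (?gen (weyl_y ` F))" for F
  proof (induction F rule: finite_induct[OF finite])
    case 1
    then show ?case using base by simp
  next
    case (2 i F)
    have "weyl_y i * g - g * weyl_y i = 0" if "g \<in> K \<union> weyl_y ` F" for g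
      using that K_comm weyl_y_commute[of i] by auto
    then have "left_noetherian (subring_set hull insert (weyl_y i) (K \<union> weyl_y ` F))"
      by (intro left_noetherian_hull_insert[OF 2(3)]) (simp add: gen_0)
    then show ?case by simp
  qed
  have xs: "left_noetherian (?gen (range weyl_y \<union> weyl_x ` F))" for F
  proof (induction F rule: finite_induct[OF finite])
    case 1
    then show ?case using ys[of UNIV] by simp
  next
    case (2 i F)
    have "weyl_x i * weyl_y j - weyl_y j * weyl_x i \<in> {0, 1}" for j
      by (cases "i = j") (simp_all add: weyl_x_y weyl_x_y_commute)
    then have comm: "weyl_x i * g - g * weyl_x i \<in> {0, 1}" if g: "g \<in> K \<union> (range weyl_y \<union> weyl_x ` F)" for g
    proof -
      consider "g \<in> K" | j where "g = weyl_y j" | j where "g = weyl_x j" using g by blast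
      then show ?thesis
        by cases (use K_comm \<open>\<And>j. weyl_x i * weyl_y j - _ \<in> _\<close> in
          \<open>simp_all only: weyl_x_commute[of i] diff_self insertI1\<close>)
    qed
    have "{0, 1} \<subseteq> ?gen (range weyl_y \<union> weyl_x ` F)" by (simp add: gen_0 gen_1)
    from left_noetherian_hull_insert[OF 2(3) subsetD[OF this comm]]
    have "left_noetherian
        (subring_set hull insert (weyl_x i) (K \<union> (range weyl_y \<union> weyl_x ` F)))" .
    then show ?case by simp
  qed
  let ?R = "?gen (range weyl_y \<union> range weyl_x)"
  have "a \<in> ?R" for a
  proof (induction a rule: weyl_induct)
    case (uminus a)
    then show ?case by (rule subring_set_uminus[OF subring_set_hull])
  next
    case (add a b)
    then show ?case by (rule subring_set_add[OF subring_set_hull])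
  next
    case (mult a b)
    then show ?case by (rule subring_set_mult[OF subring_set_hull])
  qed (auto intro!: hull_inc simp: K_def)
  then have "?R = UNIV" by blast
  then show ?thesis using xs[of UNIV] by simp
qed

section \<open>The difference operator of the shift automorphism\<close>

definition weyl_diff :: "('k::field) ^ ('n::finite) \<Rightarrow> ('k, 'n) weyl \<Rightarrow> ('k, 'n) weyl" where
  "weyl_diff k a = weyl_shift k a - a"

lemma weyl_shift_0 [simp]: "weyl_shift k 0 = 0"
  using weyl_shift_const[of k 0] by (simp add: weyl_const_0)

lemma weyl_shift_1 [simp]: "weyl_shift k 1 = 1"
  using weyl_shift_const[of k 1] by (simp add: weyl_const_1)

lemma weyl_shift_diff: "weyl_shift k (a - b) = weyl_shift k a - weyl_shift k b"
  using weyl_shift_add[of k a "- b"] by (simp add: weyl_shift_uminus)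

lemma weyl_diff_0 [simp]: "weyl_diff k 0 = 0"
  by (simp add: weyl_diff_def)

lemma weyl_diff_add: "weyl_diff k (a + b) = weyl_diff k a + weyl_diff k b"
  by (simp add: weyl_diff_def weyl_shift_add)

lemma weyl_diff_diff: "weyl_diff k (a - b) = weyl_diff k a - weyl_diff k b"
  by (simp add: weyl_diff_def weyl_shift_diff algebra_simps)

lemma weyl_diff_uminus: "weyl_diff k (- a) = - weyl_diff k a"
  by (simp add: weyl_diff_def weyl_shift_uminus)

text \<open>A twisted Leibniz rule: expand the product of \<open>a + weyl_diff k a\<close> and
  \<open>b + weyl_diff k b\<close>, using that the shift is multiplicative.\<close>

lemma weyl_diff_mult:
  "weyl_diff k (a * b) = weyl_diff k a * b + weyl_diff k a * weyl_diff k b + a * weyl_diff k b"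
  by (simp add: weyl_diff_def weyl_shift_mult algebra_simps)

lemma weyl_diff_funpow_0 [simp]: "(weyl_diff k ^^ m) 0 = 0"
  by (induction m) simp_all

lemma weyl_diff_funpow_add: "(weyl_diff k ^^ m) (a + b) = (weyl_diff k ^^ m) a + (weyl_diff k ^^ m) b"
  by (induction m) (simp_all add: weyl_diff_add)

lemma weyl_diff_funpow_diff: "(weyl_diff k ^^ m) (a - b) = (weyl_diff k ^^ m) a - (weyl_diff k ^^ m) b"
  by (induction m) (simp_all add: weyl_diff_diff)

lemma weyl_diff_funpow_uminus: "(weyl_diff k ^^ m) (- a) = - (weyl_diff k ^^ m) a"
  by (induction m) (simp_all add: weyl_diff_uminus)

lemma weyl_diff_funpow_eq_0_mono:
  assumes "(weyl_diff k ^^ m) a = 0" "m \<le> l"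
  shows "(weyl_diff k ^^ l) a = 0"
proof -
  obtain d where "l = d + m" using assms(2) by (metis le_iff_add add.commute)
  then show ?thesis using assms(1) by (simp add: funpow_add)
qed

text \<open>Induction on \<open>m + l\<close>: every term of the twisted Leibniz rule has a factor
  with a smaller nilpotency bound.\<close>

lemma weyl_diff_funpow_mult_eq_0:
  "(weyl_diff k ^^ m) a = 0 \<Longrightarrow> (weyl_diff k ^^ l) b = 0 \<Longrightarrow> (weyl_diff k ^^ (m + l)) (a * b) = 0"
proof (induction "m + l" arbitrary: m l a b)
  case (Suc n)
  show ?case
  proof (cases "m = 0 \<or> l = 0")
    case False
    then obtain m' l' where ml: "m = Suc m'" "l = Suc l'" by (meson not0_implies_Suc)
    have n: "n = m' + l" "n = m + l'" using Suc.hyps(2) ml by simp_all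
    have da: "(weyl_diff k ^^ m') (weyl_diff k a) = 0" and db: "(weyl_diff k ^^ l') (weyl_diff k b) = 0"
      using Suc.prems by (simp_all add: ml funpow_Suc_right del: funpow.simps)
    \<comment> \<open>The bound is weakened from \<open>l'\<close> to \<open>l\<close> so that the
      middle term has total \<open>m' + l = n\<close>, as the induction hypothesis requires.\<close>
    have db': "(weyl_diff k ^^ l) (weyl_diff k b) = 0"
      by (rule weyl_diff_funpow_eq_0_mono[OF db]) (simp add: ml)
    have "(weyl_diff k ^^ n) (weyl_diff k (a * b)) = 0"
      unfolding weyl_diff_mult weyl_diff_funpow_add
      using Suc.hyps(1)[OF n(1) da Suc.prems(2)] Suc.hyps(1)[OF n(1) da db']
        Suc.hyps(1)[OF n(2) Suc.prems(1) db] n by simp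
    then show ?thesis
      using Suc.hyps(2)[symmetric] by (simp add: funpow_Suc_right del: funpow.simps)
  next
    case True
    then have "a * b = 0" using Suc.prems by auto
    then show ?thesis by simp
  qed
qed auto

text \<open>The operator kills \<open>weyl_x i\<close> and scalars at once and
  \<open>weyl_y i\<close> after two steps; sums and products inherit nilpotency.\<close>

lemma weyl_diff_locally_nilpotent: "\<exists>m. (weyl_diff k ^^ m) a = 0"
proof (induction a rule: weyl_induct)
  case (x i)
  show ?case by (rule exI[of _ 1]) (simp add: weyl_diff_def weyl_shift_x)
next
  case (y i)
  show ?case
    by (rule exI[of _ 2])
      (simp add: weyl_diff_def weyl_shift_y weyl_shift_const weyl_shift_add numeral_2_eq_2)
next
  case (const c)
  show ?case by (rule exI[of _ 1]) (simp add: weyl_diff_def weyl_shift_const)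
next
  case (uminus a)
  then show ?case by (simp add: weyl_diff_funpow_uminus)
next
  case (add a b)
  then obtain m l where "(weyl_diff k ^^ m) a = 0" "(weyl_diff k ^^ l) b = 0" by blast
  then have "(weyl_diff k ^^ max m l) a = 0" "(weyl_diff k ^^ max m l) b = 0"
    by (auto intro: weyl_diff_funpow_eq_0_mono)
  then have "(weyl_diff k ^^ max m l) (a + b) = 0" by (simp add: weyl_diff_funpow_add)
  then show ?case by blast
next
  case (mult a b)
  then show ?case using weyl_diff_funpow_mult_eq_0 by blast
qed

section \<open>Left ideals\<close>

lemma hom_weyl_left_idealD:
  assumes "hom_weyl_left_ideal k I"
  shows hom_weyl_left_ideal_diff: "a \<in> I \<Longrightarrow> b \<in> I \<Longrightarrow> a - b \<in> I"
    and hom_weyl_left_ideal_add: "a \<in> I \<Longrightarrow> b \<in> I \<Longrightarrow> a + b \<in> I"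
    and hom_weyl_left_ideal_zero: "0 \<in> I"
  using assms unfolding hom_weyl_left_ideal_def
  by (blast intro: weyl.subspace_diff weyl.subspace_add weyl.subspace_0)+

text \<open>The twisted product of 1 with \<open>a\<close> is the shift of \<open>a\<close>.\<close>

lemma hom_weyl_left_ideal_weyl_shift:
  "hom_weyl_left_ideal k I \<Longrightarrow> a \<in> I \<Longrightarrow> weyl_shift k a \<in> I"
  unfolding hom_weyl_left_ideal_def hom_weyl_mult_def by (metis mult_1)

lemma hom_weyl_left_ideal_weyl_diff:
  "hom_weyl_left_ideal k I \<Longrightarrow> a \<in> I \<Longrightarrow> weyl_diff k a \<in> I"
  unfolding weyl_diff_def by (blast intro: hom_weyl_left_ideal_diff hom_weyl_left_ideal_weyl_shift)

lemma hom_weyl_left_ideal_weyl_diff_funpow: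
  "hom_weyl_left_ideal k I \<Longrightarrow> a \<in> I \<Longrightarrow> (weyl_diff k ^^ m) a \<in> I"
  by (induction m) (auto intro: hom_weyl_left_ideal_weyl_diff)

text \<open>Since the difference operator is locally nilpotent, an ideal stable under the shift is also
  stable under its inverse.\<close>

lemma hom_weyl_left_ideal_weyl_shift_iff:
  assumes I: "hom_weyl_left_ideal k I"
  shows "weyl_shift k a \<in> I \<longleftrightarrow> a \<in> I"
proof
  have "a \<in> I" if "(weyl_diff k ^^ m) a = 0" "weyl_shift k a \<in> I" for m
    using that
  proof (induction m arbitrary: a)
    case 0
    then show ?case using hom_weyl_left_ideal_zero[OF I] by simp
  next
    case (Suc m)
    \<comment> \<open>The induction hypothesis applies to \<open>weyl_diff k a\<close>, and
      \<open>a\<close> is its shift minus its difference.\<close>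
    have "weyl_shift k (weyl_diff k a) = weyl_diff k (weyl_shift k a)"
      by (simp add: weyl_diff_def weyl_shift_diff)
    then have "weyl_diff k a \<in> I"
      using Suc hom_weyl_left_ideal_weyl_diff[OF I]
      by (simp add: funpow_Suc_right del: funpow.simps)
    then have "weyl_shift k a - weyl_diff k a \<in> I"
      using Suc.prems(2) by (blast intro: hom_weyl_left_ideal_diff[OF I])
    then show ?case by (simp add: weyl_diff_def)
  qed
  then show "weyl_shift k a \<in> I \<Longrightarrow> a \<in> I" using weyl_diff_locally_nilpotent by blast
qed (rule hom_weyl_left_ideal_weyl_shift[OF I])

text \<open>The ideal contains the shift of \<open>a * q\<close>, and the shift can be undone. This
  makes the ideal an ordinary left ideal, to which left Noetherianity applies.\<close>

lemma hom_weyl_left_ideal_mult: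
  "hom_weyl_left_ideal k I \<Longrightarrow> q \<in> I \<Longrightarrow> a * q \<in> I"
  using hom_weyl_left_ideal_weyl_shift_iff[of k I "a * q"]
  unfolding hom_weyl_left_ideal_def hom_weyl_mult_def by blast

lemma hom_weyl_left_ideal_left_submodule:
  "hom_weyl_left_ideal k I \<Longrightarrow> left_submodule UNIV I"
  unfolding left_submodule_def
  by (blast intro: hom_weyl_left_ideal_zero hom_weyl_left_ideal_add hom_weyl_left_ideal_mult)

lemma hom_weyl_left_ideal_sum:
  assumes "hom_weyl_left_ideal k I" "\<And>j. j \<in> A \<Longrightarrow> f j \<in> I"
  shows "sum f A \<in> I"
  using assms unfolding hom_weyl_left_ideal_def by (blast intro: weyl.subspace_sum)

section \<open>Constants of the difference operator and recovery from one element\<close>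

locale antidifference =
  fixes k :: "('k::field) ^ ('n::finite)" and b :: "nat \<Rightarrow> ('k, 'n) weyl"
  assumes b_0: "b 0 = 1" and weyl_diff_b: "weyl_diff k (b (Suc j)) = b j"
begin

text \<open>A constant \<open>c\<close> on the right passes through the operator, so each step only
  lowers the index of \<open>b\<close>.\<close>

lemma weyl_diff_funpow_b:
  assumes "weyl_diff k c = 0"
  shows "(weyl_diff k ^^ j) (b j * c) = c"
proof (induction j)
  case (Suc j)
  have "weyl_diff k (b (Suc j) * c) = b j * c" by (simp add: weyl_diff_mult weyl_diff_b assms)
  then show ?case using Suc by (simp add: funpow_Suc_right del: funpow.simps)
qed (simp add: b_0)

lemma weyl_diff_funpow_b_eq_0:
  assumes "weyl_diff k c = 0" "j < m"
  shows "(weyl_diff k ^^ m) (b j * c) = 0"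
proof (rule weyl_diff_funpow_eq_0_mono)
  show "(weyl_diff k ^^ Suc j) (b j * c) = 0" by (simp add: weyl_diff_funpow_b assms)
qed (use assms in simp)

text \<open>A discrete Taylor expansion: the last nonvanishing difference \<open>c\<close> is a
  constant in \<open>I\<close>, and subtracting \<open>b m * c\<close> lowers the nilpotency bound
  of \<open>a\<close>.\<close>

lemma mem_left_submodule_hull_constants:
  assumes I: "hom_weyl_left_ideal k I" and "a \<in> I"
  shows "\<exists>C. finite C \<and> C \<subseteq> {c \<in> I. weyl_diff k c = 0} \<and> a \<in> left_submodule UNIV hull C"
proof -
  have "\<exists>C. finite C \<and> C \<subseteq> {c \<in> I. weyl_diff k c = 0} \<and> a \<in> left_submodule UNIV hull C"
    if "(weyl_diff k ^^ m) a = 0" "a \<in> I" for m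
    using that
  proof (induction m arbitrary: a)
    case 0
    then have "a \<in> left_submodule UNIV hull {}" using left_submodule_zero[OF left_submodule_hull] by simp
    then show ?case by blast
  next
    case (Suc m)
    define c where "c = (weyl_diff k ^^ m) a"
    have c: "c \<in> I" "weyl_diff k c = 0"
      using Suc.prems hom_weyl_left_ideal_weyl_diff_funpow[OF I] by (simp_all add: c_def)
    have "(weyl_diff k ^^ m) (a - b m * c) = 0"
      using weyl_diff_funpow_b[OF c(2), of m] by (simp add: weyl_diff_funpow_diff c_def)
    moreover have "a - b m * c \<in> I"
      by (intro hom_weyl_left_ideal_diff[OF I] hom_weyl_left_ideal_mult[OF I] Suc.prems c)
    ultimately obtain C where C: "finite C" "C \<subseteq> {c \<in> I. weyl_diff k c = 0}"
      "a - b m * c \<in> left_submodule UNIV hull C"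
      using Suc.IH by blast
    let ?H = "left_submodule UNIV hull (insert c C)"
    have "a - b m * c \<in> ?H" using C(3) hull_mono[of C "insert c C"] by blast
    moreover have "b m * c \<in> ?H"
      by (intro left_submodule_mult[OF left_submodule_hull] hull_inc) auto
    ultimately have "(a - b m * c) + b m * c \<in> ?H" by (rule left_submodule_add[OF left_submodule_hull])
    then show ?case using C c by (intro exI[of _ "insert c C"]) auto
  qed
  moreover obtain m where "(weyl_diff k ^^ m) a = 0" using weyl_diff_locally_nilpotent by blast
  ultimately show ?thesis using assms(2) .
qed

text \<open>The highest power of the operator isolates the last coefficient; once its term is
  subtracted, the shorter sum is treated by induction.\<close>

lemma mem_of_sum_mem:
  assumes J: "hom_weyl_left_ideal k J" and c: "\<And>j. weyl_diff k (c j) = 0"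
    and "(\<Sum>j<r. b j * c j) \<in> J" and "j < r"
  shows "c j \<in> J"
  using assms(3,4)
proof (induction r arbitrary: j)
  case (Suc r)
  have "(weyl_diff k ^^ r) (\<Sum>j<l. b j * c j) = 0" if "l \<le> r" for l
    using that
  proof (induction l)
    case (Suc l)
    then show ?case
      using weyl_diff_funpow_b_eq_0[OF c, of l r] by (simp add: weyl_diff_funpow_add)
  qed simp
  from this[of r] have "(weyl_diff k ^^ r) (\<Sum>j<Suc r. b j * c j) = c r"
    using weyl_diff_funpow_b[OF c] by (simp add: weyl_diff_funpow_add)
  with hom_weyl_left_ideal_weyl_diff_funpow[OF J Suc.prems(1), of r] have r: "c r \<in> J" by simp
  then have "(\<Sum>j<Suc r. b j * c j) - b r * c r \<in> J"
    by (intro hom_weyl_left_ideal_diff[OF J] hom_weyl_left_ideal_mult[OF J] Suc.prems)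
  then have "(\<Sum>j<r. b j * c j) \<in> J" by simp
  then show ?case using Suc.IH Suc.prems(2) r less_antisym by blast
qed simp

text \<open>Noetherianity gives finitely many generators, each a left combination of finitely many
  constants of \<open>I\<close>. An ideal containing \<open>q\<close> contains all of these
  constants, hence \<open>I\<close>.\<close>

lemma hom_weyl_left_ideal_principal:
  assumes I: "hom_weyl_left_ideal k I"
  shows "hom_weyl_principal_left k I"
proof -
  obtain F where F: "finite F" "I = left_submodule UNIV hull F"
    by (rule left_noetherianD[OF left_noetherian_weyl subset_UNIV hom_weyl_left_ideal_left_submodule[OF I]])
  have "\<forall>f\<in>F. \<exists>C. finite C \<and> C \<subseteq> {c \<in> I. weyl_diff k c = 0} \<and> f \<in> left_submodule UNIV hull C"
  proof
    fix f assume "f \<in> F"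
    then have "f \<in> I" by (simp add: F(2) hull_inc)
    then show "\<exists>C. finite C \<and> C \<subseteq> {c \<in> I. weyl_diff k c = 0} \<and> f \<in> left_submodule UNIV hull C"
      by (rule mem_left_submodule_hull_constants[OF I])
  qed
  from bchoice[OF this] obtain C where C: "\<And>f. f \<in> F \<Longrightarrow> finite (C f)"
    "\<And>f. f \<in> F \<Longrightarrow> C f \<subseteq> {c \<in> I. weyl_diff k c = 0}"
    "\<And>f. f \<in> F \<Longrightarrow> f \<in> left_submodule UNIV hull C f"
    by auto
  obtain cs where cs: "set cs = \<Union>(C ` F)"
    using finite_list[of "\<Union>(C ` F)"] F(1) C(1) by blast
  define r where "r = length cs"
  \<comment> \<open>The value 0 beyond the list makes every \<open>c j\<close> a constant, as
    \<open>mem_of_sum_mem\<close> demands for all indices.\<close>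
  define c where "c j = (if j < r then cs ! j else 0)" for j
  have "insert 0 (set cs) \<subseteq> {c \<in> I. weyl_diff k c = 0}"
    using C(2) hom_weyl_left_ideal_zero[OF I] unfolding cs by auto
  moreover have "c j \<in> insert 0 (set cs)" for j by (simp add: c_def r_def)
  ultimately have c: "c j \<in> I" "weyl_diff k (c j) = 0" for j by blast+
  define q where "q = (\<Sum>j<r. b j * c j)"
  have "I = hom_weyl_left_ideal k hull {q}"
  proof (rule hull_unique[symmetric])
    have "q \<in> I" unfolding q_def
      by (intro hom_weyl_left_ideal_sum[OF I] hom_weyl_left_ideal_mult[OF I] c)
    then show "{q} \<subseteq> I" by simp
  next
    fix J assume J: "{q} \<subseteq> J" "hom_weyl_left_ideal k J"
    have "set cs \<subseteq> J"
    proof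
      fix d assume "d \<in> set cs"
      then obtain j where "j < r" "d = c j" by (auto simp: in_set_conv_nth r_def c_def)
      then show "d \<in> J" using mem_of_sum_mem[OF J(2) c(2) _ \<open>j < r\<close>] J(1) q_def by simp
    qed
    then have "C f \<subseteq> J" if "f \<in> F" for f using cs that by blast
    then have "left_submodule UNIV hull C f \<subseteq> J" if "f \<in> F" for f
      using that by (intro hull_minimal) (simp_all add: hom_weyl_left_ideal_left_submodule[OF J(2)])
    then have "F \<subseteq> J" using C(3) by blast
    then show "I \<subseteq> J"
      unfolding F(2) by (rule hull_minimal) (rule hom_weyl_left_ideal_left_submodule[OF J(2)])
  qed (rule I)
  then show ?thesis unfolding hom_weyl_principal_left_def by blast
qed

end

section \<open>Existence of antidifferences in characteristic zero\<close>

lemma weyl_const_of_nat: "weyl_const (of_nat m) = of_nat m"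
  by (induction m) (simp_all add: weyl_const_0 weyl_const_1 weyl_const_add)

text \<open>The binomial polynomials in \<open>t = y\<^sub>i / k\<^sub>i\<close>, which the shift maps to \<open>t + 1\<close>.\<close>

lemma antidifference_exists:
  fixes k :: "('k::field_char_0) ^ ('n::finite)"
  assumes "k $ i \<noteq> 0"
  shows "\<exists>b. antidifference k b"
proof -
  define t :: "('k, 'n) weyl" where "t = weyl_scale (inverse (k $ i)) (weyl_y i)"
  have shift_t: "weyl_shift k t = t + 1"
    using assms
    by (simp add: t_def weyl_shift_scale weyl_shift_y weyl.scale_right_distrib)
      (simp add: weyl_scale_def weyl_const_mult[symmetric] weyl_const_1)
  \<comment> \<open>The falling factorials \<open>t * (t - 1) * ... * (t - (j - 1))\<close>.\<close>
  define f :: "nat \<Rightarrow> ('k, 'n) weyl" where "f = rec_nat 1 (\<lambda>j p. p * (t - of_nat j))"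
  have f: "f 0 = 1" "\<And>j. f (Suc j) = f j * (t - of_nat j)" by (simp_all add: f_def)
  have t_f: "t * f j = f j * t" for j
  proof (induction j)
    case (Suc j)
    have "t * f (Suc j) = f j * (t * (t - of_nat j))"
      by (simp add: f mult.assoc[symmetric] Suc)
    also have "t * (t - of_nat j) = (t - of_nat j) * t"
      by (simp add: algebra_simps mult_of_nat_commute)
    finally show ?case by (simp add: f mult.assoc)
  qed (simp add: f)
  have shift_nat: "weyl_shift k (of_nat j) = of_nat j" for j
    using weyl_shift_const[of k "of_nat j"] by (simp add: weyl_const_of_nat)
  \<comment> \<open>Replacing \<open>t\<close> by \<open>t + 1\<close> moves every factor up by one:
    a new factor \<open>t + 1\<close> appears and the last factor is lost.\<close>
  have shift_f: "weyl_shift k (f (Suc j)) = (t + 1) * f j" for j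
  proof (induction j)
    case 0
    show ?case by (simp add: f shift_t)
  next
    case (Suc j)
    have "weyl_shift k (f (Suc (Suc j))) = weyl_shift k (f (Suc j)) * (t + 1 - of_nat (Suc j))"
      by (simp add: f(2)[of "Suc j"] weyl_shift_mult weyl_shift_diff shift_t shift_nat weyl_shift_add)
    also have "t + 1 - of_nat (Suc j) = t - of_nat j" by simp
    also have "weyl_shift k (f (Suc j)) * (t - of_nat j) = (t + 1) * f (Suc j)"
      unfolding Suc by (simp only: f(2)[of j] mult.assoc)
    finally show ?case .
  qed
  have diff_f: "weyl_diff k (f (Suc j)) = weyl_scale (of_nat (Suc j)) (f j)" for j
  proof -
    have "weyl_diff k (f (Suc j)) = (t + 1) * f j - f j * (t - of_nat j)"
      unfolding weyl_diff_def shift_f by (simp only: f(2))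
    also have "\<dots> = of_nat (Suc j) * f j"
      by (simp add: algebra_simps t_f mult_of_nat_commute)
    finally show ?thesis by (simp only: weyl_scale_def weyl_const_of_nat)
  qed
  \<comment> \<open>Division by \<open>fact j\<close> absorbs the factor
    \<open>of_nat (Suc j)\<close> in \<open>diff_f\<close>; characteristic zero makes the factorials
    invertible.\<close>
  have "antidifference k (\<lambda>j. weyl_scale (inverse (fact j)) (f j))"
  proof
    fix j
    have "weyl_diff k (weyl_scale (inverse (fact (Suc j))) (f (Suc j))) =
        weyl_scale (inverse (fact (Suc j))) (weyl_diff k (f (Suc j)))"
      by (simp add: weyl_diff_def weyl_shift_scale weyl.scale_right_diff_distrib)
    also have "\<dots> = weyl_scale (inverse (fact j)) (f j)"
      by (simp add: diff_f field_simps del: of_nat_Suc)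
    finally show "weyl_diff k (weyl_scale (inverse (fact (Suc j))) (f (Suc j))) =
      weyl_scale (inverse (fact j)) (f j)" .
  qed (simp add: f)
  then show ?thesis by blast
qed

section \<open>Right ideals\<close>

text \<open>Reversing products alone would change the sign of the commutator of
  \<open>weyl_x i\<close> and \<open>weyl_y i\<close>; the negated \<open>TY i\<close> restores the
  relation.\<close>

primrec weyl_rev_term :: "('k::field, 'n) weyl_term \<Rightarrow> ('k, 'n) weyl_term" where
  "weyl_rev_term (TX i) = TX i"
| "weyl_rev_term (TY i) = TNeg (TY i)"
| "weyl_rev_term (TC c) = TC c"
| "weyl_rev_term (TNeg s) = TNeg (weyl_rev_term s)"
| "weyl_rev_term (TAdd s t) = TAdd (weyl_rev_term s) (weyl_rev_term t)"
| "weyl_rev_term (TMul s t) = TMul (weyl_rev_term t) (weyl_rev_term s)"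

lemma weyl_rev_term_cong:
  "weyl_eq s t \<Longrightarrow> weyl_eq (weyl_rev_term s) (weyl_rev_term t)"
proof (induction rule: weyl_eq.induct)
  case (weyl_trans s t u)
  then show ?case by (blast intro: weyl_eq.weyl_trans)
next
  case (weyl_sym s t)
  then show ?case by (blast intro: weyl_eq.weyl_sym)
next
  case (weyl_mul_assoc s t u)
  show ?case by (simp add: weyl_eq.weyl_sym weyl_eq.weyl_mul_assoc)
next
  \<comment> \<open>Reversal swaps the two scalars, so their centrality is used as well.\<close>
  case (weyl_scalar_mul a b)
  show ?case
    using weyl_eq.weyl_trans[OF weyl_eq.weyl_scalar_mul weyl_eq.weyl_scalar_central] by simp
next
  case (weyl_scalar_central a s)
  show ?case by (simp add: weyl_eq.weyl_sym weyl_eq.weyl_scalar_central)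
next
  case (weyl_rel_xx i j)
  show ?case by (simp add: weyl_eq.weyl_rel_xx)
next
  case (weyl_rel_yy i j)
  have "- weyl_y j * - weyl_y i = - weyl_y i * - (weyl_y j :: ('a, 'b) weyl)"
    by (simp add: weyl_y_commute)
  then show ?case by transfer simp
next
  case (weyl_rel_xy_neq i j)
  then have "- weyl_y j * weyl_x i = weyl_x i * - (weyl_y j :: ('a, 'b) weyl)"
    by (simp add: weyl_x_y_commute)
  then show ?case by transfer simp
next
  case (weyl_rel_xy i)
  have "- weyl_y i * weyl_x i = weyl_x i * - weyl_y i + (1 :: ('a, 'b) weyl)"
    by (simp add: weyl_x_y)
  then show ?case by transfer simp
qed (unfold weyl_rev_term.simps, (rule weyl_eq.intros; assumption)+)

lift_definition weyl_rev :: "('k::field, 'n) weyl \<Rightarrow> ('k, 'n) weyl" is weyl_rev_term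
  by (rule weyl_rev_term_cong)

lemma weyl_rev_x: "weyl_rev (weyl_x i) = weyl_x i"
  and weyl_rev_y: "weyl_rev (weyl_y i) = - weyl_y i"
  and weyl_rev_const: "weyl_rev (weyl_const c) = weyl_const c"
  and weyl_rev_uminus: "weyl_rev (- a) = - weyl_rev a"
  and weyl_rev_add: "weyl_rev (a + b) = weyl_rev a + weyl_rev b"
  and weyl_rev_mult: "weyl_rev (a * b) = weyl_rev b * weyl_rev a"
  by (transfer; simp add: weyl_refl)+

lemma weyl_rev_rev [simp]: "weyl_rev (weyl_rev a) = a"
  by (induction a rule: weyl_induct)
    (simp_all add: weyl_rev_x weyl_rev_y weyl_rev_const weyl_rev_uminus weyl_rev_add weyl_rev_mult)

lemma weyl_rev_0: "weyl_rev 0 = 0"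
  by (simp add: weyl_const_0[symmetric] weyl_rev_const)

lemma weyl_rev_scale: "weyl_rev (weyl_scale c a) = weyl_scale c (weyl_rev a)"
  by (simp add: weyl_scale_def weyl_rev_mult weyl_rev_const weyl_const_commute)

text \<open>On \<open>weyl_y i\<close> both sides are
  \<open>- weyl_y i + weyl_const (k $ i)\<close>: the sign in the reversal flips the direction of
  the shift.\<close>

lemma weyl_rev_shift: "weyl_rev (weyl_shift k a) = weyl_shift (- k) (weyl_rev a)"
  by (induction a rule: weyl_induct)
    (simp_all add: weyl_rev_x weyl_rev_y weyl_rev_const weyl_rev_uminus weyl_rev_add weyl_rev_mult
      weyl_shift_x weyl_shift_y weyl_shift_const weyl_shift_uminus weyl_shift_add weyl_shift_mult
      weyl_const_uminus)

lemma weyl_rev_hom_mult: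
  "weyl_rev (hom_weyl_mult k a b) = hom_weyl_mult (- k) (weyl_rev b) (weyl_rev a)"
  by (simp add: hom_weyl_mult_def weyl_rev_shift weyl_rev_mult)

lemma mem_weyl_rev_image: "a \<in> weyl_rev ` I \<longleftrightarrow> weyl_rev a \<in> I"
  by (metis imageE imageI weyl_rev_rev)

lemma subspace_weyl_rev_image: "weyl.subspace I \<Longrightarrow> weyl.subspace (weyl_rev ` I)"
  unfolding weyl.subspace_def by (simp add: weyl_rev_0 mem_weyl_rev_image weyl_rev_add weyl_rev_scale)

lemma hom_weyl_left_ideal_weyl_rev_image:
  "hom_weyl_right_ideal k I \<Longrightarrow> hom_weyl_left_ideal (- k) (weyl_rev ` I)"
  unfolding hom_weyl_right_ideal_def hom_weyl_left_ideal_def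
  by (simp add: subspace_weyl_rev_image mem_weyl_rev_image weyl_rev_hom_mult)

text \<open>The reversal is an inclusion-preserving involution exchanging the two kinds of ideals,
  so it carries generators to generators.\<close>

lemma hom_weyl_principal_right_of_left:
  assumes I: "hom_weyl_right_ideal k I" and "hom_weyl_principal_left (- k) (weyl_rev ` I)"
  shows "hom_weyl_principal_right k I"
proof -
  obtain p where p: "weyl_rev ` I = hom_weyl_left_ideal (- k) hull {p}"
    using assms(2) by (auto simp: hom_weyl_principal_left_def)
  have "I = hom_weyl_right_ideal k hull {weyl_rev p}"
  proof (rule hull_unique[symmetric])
    have "p \<in> weyl_rev ` I" unfolding p by (rule hull_inc) simp
    then show "{weyl_rev p} \<subseteq> I" by (simp add: mem_weyl_rev_image)
  next
    fix J assume J: "{weyl_rev p} \<subseteq> J" "hom_weyl_right_ideal k J"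
    then have "weyl_rev ` I \<subseteq> weyl_rev ` J"
      unfolding p
      by (intro hull_minimal hom_weyl_left_ideal_weyl_rev_image) (auto simp: mem_weyl_rev_image)
    then show "I \<subseteq> J" by (metis image_eqI mem_weyl_rev_image subset_iff weyl_rev_rev)
  qed (rule I)
  then show ?thesis unfolding hom_weyl_principal_right_def by blast
qed

theorem theorem1:
  fixes k :: "('k::field_char_0) ^ ('n::finite)"
  assumes "(\<Prod>i\<in>UNIV. k $ i) \<noteq> 0"
  shows "(\<forall>I. hom_weyl_left_ideal k I \<longrightarrow> hom_weyl_principal_left k I) \<and>
         (\<forall>I. hom_weyl_right_ideal k I \<longrightarrow> hom_weyl_principal_right k I)"
proof -
  \<comment> \<open>The index type is nonempty, so an index exists; \<open>k $ i\<close> is a factor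
    of a nonzero product. The parameter \<open>- k\<close> serves the right ideals.\<close>
  fix i :: 'n
  have "k $ i \<noteq> 0" using assms by simp
  then have "(- k) $ i \<noteq> 0" by simp
  obtain b b' where "antidifference k b" "antidifference (- k) b'"
    using antidifference_exists[OF \<open>k $ i \<noteq> 0\<close>] antidifference_exists[OF \<open>(- k) $ i \<noteq> 0\<close>] by blast
  then show ?thesis
    using antidifference.hom_weyl_left_ideal_principal hom_weyl_principal_right_of_left
      hom_weyl_left_ideal_weyl_rev_image by blast
qed

end
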